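(* Let $\mathscr{B}\subseteq\mathbb{R}^2$ be a set of points $(y,z)$ with $z>0$, let $\mathscr{D}=\{y/z:(y,z)\in\mathscr{B}\}$, and let $b_0<b_1<\dots<b_\ell$ be breakpoints with $\mathscr{D}\subseteq[b_0,b_\ell)$. Let $\phi$ be a real-valued increasing function on a subset of $\mathbb{R}$ containing $\mathscr{D}$ and all breakpoints, and let $\psi(y,z)=\phi(y/z)$. If $\mathscr{M}$ and $\mathscr{N}$ are sufficiently large, then $$\operatorname{proj}_{\left(r=\frac{y}{z},\,f\right)}\left(\widehat{\operatorname{step}}_{\{b_k\}}(\psi)\right)=\operatorname{step}_{\{b_k\}}(\phi).$$
   Context: $\widehat{\operatorname{step}}_{\{b_k\}}(\psi)$ is the set of $(y,z,f,\boldsymbol\delta)\in\mathscr{B}\times\mathbb{R}\times\{0,1\}^\ell$ such that $$f-\phi(b_k)\le\mathscr{N}(1-\delta_k)\ \ (k=1,\dots,\ell),\qquad b_kz-y\le\mathscr{M}\delta_k\ \ (k=1,\dots,\ell),\qquad\delta_{k-1}\le\delta_k\ \ (k=2,\dots,\ell).$$ Here $\mathscr{M},\mathscr{N}$ are real constants; "sufficiently large" means $\mathscr{M}\ge b_kz-y$ for all $(y,z)\in\mathscr{B}$ and all $k\in\{1,\dots,\ell\}$, and $\mathscr{N}\ge\phi(b_\ell)-\phi(b_k)$ for all $k\in\{1,\dots,\ell\}$. $\operatorname{step}_{\{b_k\}}(\phi)=\{(r,f)\in\mathscr{D}\times\mathbb{R}:\ \text{for all }k\in\{1,\dots,\ell\},\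 \text{if } r\in[b_{k-1},b_k)\text{ then } f\le\phi(b_k)\}$. $\operatorname{proj}_{(r=y/z,f)}(S)$ denotes $\{(y/z,f):(y,z,f,\boldsymbol\delta)\in S\text{ for some }\boldsymbol\delta\}$. *)

theory Defs
  imports Complex_Main "HOL-Library.FuncSet"
begin

definition ratios :: "(real \<times> real) set \<Rightarrow> real set" where
  "ratios B = {y / z | y z. (y, z) \<in> B}"

definition step ::
  "nat \<Rightarrow> (nat \<Rightarrow> real) \<Rightarrow> real set \<Rightarrow> (real \<Rightarrow> real) \<Rightarrow> (real \<times> real) set" where
  "step l b D \<phi> =
    {(r, f). r \<in> D \<and> (\<forall>k\<in>{1..l}. r \<in> {b (k - 1)..<b k} \<longrightarrow> f \<le> \<phi> (b k))}"

(* The composite \<psi>(y, z) = \<phi>(y / z) enters the constraints only through the values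
   \<phi>(b k), which \<psi> restricted to B need not determine (b k need not be a ratio of B);
   hence \<phi> itself is the parameter.  An element of {0,1}^l is a function on {1..l}
   that is undefined elsewhere. *)
definition step_hat ::
  "real \<Rightarrow> real \<Rightarrow> nat \<Rightarrow> (nat \<Rightarrow> real) \<Rightarrow> (real \<times> real) set \<Rightarrow> (real \<Rightarrow> real) \<Rightarrow>
    (real \<times> real \<times> real \<times> (nat \<Rightarrow> real)) set" where
  "step_hat M N l b B \<phi> =
    {(y, z, f, \<delta>). (y, z) \<in> B \<and> \<delta> \<in> {1..l} \<rightarrow>\<^sub>E {0, 1} \<and>
      (\<forall>k\<in>{1..l}. f - \<phi> (b k) \<le> N * (1 - \<delta> k)) \<and>
      (\<forall>k\<in>{1..l}. b k * z - y \<le> M * \<delta> k) \<and>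
      (\<forall>k\<in>{2..l}. \<delta> (k - 1) \<le> \<delta> k)}"

definition proj_ratio ::
  "(real \<times> real \<times> real \<times> (nat \<Rightarrow> real)) set \<Rightarrow> (real \<times> real) set" where
  "proj_ratio S = {(y / z, f) | y z f \<delta>. (y, z, f, \<delta>) \<in> S}"

end

theory Submission
  imports Defs
begin

text \<open>
  Where \<open>r = y / z\<close>, the sign of \<open>b k * z - y\<close> tells whether \<open>r < b k\<close>, since \<open>z > 0\<close>. The second
  family of constraints therefore forces \<open>\<delta> k = 1\<close> whenever \<open>r < b k\<close>, and then the first family
  gives \<open>f \<le> \<phi> (b k)\<close>; for the cell \<open>{b (k - 1)..<b k}\<close> that contains \<open>r\<close>, this is the bound that
  the step relaxation asks for. Conversely, a point of the step relaxation is lifted by the least \<open>\<delta>\<close> that this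
  permits, the indicator of \<open>r < b k\<close>. It is monotone in \<open>k\<close> because the breakpoints increase, and
  the constraint on \<open>f\<close> holds because the bound \<open>f \<le> \<phi> (b j)\<close> of the cell of \<open>r\<close> propagates to all
  later breakpoints (\<open>le_value_at_later_breakpoint\<close>), while its consequence \<open>f \<le> \<phi> (b l)\<close> leaves
  room \<open>N\<close> at the earlier ones.
\<close>

text \<open>
  The cell index is the least \<open>j\<close> with \<open>r < b j\<close>; minimality supplies the lower end of the cell.
\<close>

lemma breakpoint_cell_exists:
  fixes b :: "nat \<Rightarrow> 'a::linorder"
  assumes "b 0 \<le> r" and "r < b k"
  obtains j where "j \<in> {1..k}" and "r \<in> {b (j - 1)..<b j}"
proof -
  define j where "j = (LEAST j. r < b j)"
  have lt: "r < b j" and le: "j \<le> k"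
    unfolding j_def using assms(2) by (rule LeastI, rule Least_le)
  have "j \<noteq> 0" using lt assms(1) by (metis not_le)
  moreover from this have "\<not> r < b (j - 1)"
    unfolding j_def by (intro not_less_Least) simp
  ultimately show thesis using that[of j] lt le by simp
qed

text \<open>
  The step relaxation constrains \<open>f\<close> only at the right end \<open>b j\<close> of the cell of \<open>r\<close>. As \<open>\<phi>\<close> increases,
  this is the strongest of the bounds \<open>f \<le> \<phi> (b k)\<close> with \<open>r < b k\<close>.
\<close>

lemma le_value_at_later_breakpoint:
  assumes step: "(r, f) \<in> step l b D \<phi>"
    and mono: "mono_on {0..l} (\<lambda>k. \<phi> (b k))"
    and "b 0 \<le> r" and "r < b k" and "k \<le> l"
  shows "f \<le> \<phi> (b k)"
proof -
  obtain j where j: "j \<in> {1..k}" "r \<in> {b (j - 1)..<b j}"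
    using breakpoint_cell_exists[of b r k] assms(3,4) by blast
  with step \<open>k \<le> l\<close> have "f \<le> \<phi> (b j)"
    by (auto simp: step_def)
  also have "\<dots> \<le> \<phi> (b k)"
    using mono_onD[OF mono, of j k] j \<open>k \<le> l\<close> by simp
  finally show ?thesis .
qed

theorem proposition6:
  fixes B :: "(real \<times> real) set"
    and l :: nat
    and b :: "nat \<Rightarrow> real"
    and T :: "real set"
    and \<phi> :: "real \<Rightarrow> real"
    and M N :: real
  assumes "\<And>y z. (y, z) \<in> B \<Longrightarrow> z > 0"
    and "strict_mono_on {0..l} b"
    and "ratios B \<subseteq> {b 0..<b l}"
    and "ratios B \<subseteq> T"
    and "b ` {0..l} \<subseteq> T"
    and "mono_on T \<phi>"
    and "\<And>y z k. (y, z) \<in> B \<Longrightarrow> k \<in> {1..l} \<Longrightarrow> M \<ge> b k * z - y"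
    and "\<And>k. k \<in> {1..l} \<Longrightarrow> N \<ge> \<phi> (b l) - \<phi> (b k)"
  shows "proj_ratio (step_hat M N l b B \<phi>) = step l b (ratios B) \<phi>"
proof (intro equalityI subrelI)
  fix r f
  assume "(r, f) \<in> proj_ratio (step_hat M N l b B \<phi>)"
  then obtain y z \<delta> where r: "r = y / z" and yz: "(y, z) \<in> B"
    and \<delta>: "\<delta> \<in> {1..l} \<rightarrow>\<^sub>E {0, 1}"
    and f_le: "\<forall>k\<in>{1..l}. f - \<phi> (b k) \<le> N * (1 - \<delta> k)"
    and sign_le: "\<forall>k\<in>{1..l}. b k * z - y \<le> M * \<delta> k"
    unfolding proj_ratio_def step_hat_def by blast
  have "f \<le> \<phi> (b k)" if k: "k \<in> {1..l}" and "r < b k" for k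
  proof -
    have "0 < b k * z - y"
      using \<open>r < b k\<close> assms(1)[OF yz] by (simp add: r divide_less_eq)
    also have "\<dots> \<le> M * \<delta> k" using sign_le k by blast
    finally have "\<delta> k \<noteq> 0" by auto
    moreover have "\<delta> k \<in> {0, 1}" using PiE_mem[OF \<delta> k] .
    moreover have "f - \<phi> (b k) \<le> N * (1 - \<delta> k)" using f_le k by blast
    ultimately show ?thesis by simp
  qed
  moreover have "r \<in> ratios B"
    using r yz by (auto simp: ratios_def)
  ultimately show "(r, f) \<in> step l b (ratios B) \<phi>"
    by (auto simp: step_def)
next
  fix r f
  assume rf: "(r, f) \<in> step l b (ratios B) \<phi>"
  then have "r \<in> ratios B" by (simp add: step_def)
  then obtain y z where r: "r = y / z" and yz: "(y, z) \<in> B"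
    by (auto simp: ratios_def)
  have r_bounds: "b 0 \<le> r" "r < b l"
    using assms(3) \<open>r \<in> ratios B\<close> by auto
  have b_mono: "b i \<le> b k" if "i \<le> k" "k \<le> l" for i k
    using strict_mono_on_leD[OF assms(2)] that by simp
  have \<phi>b_mono: "mono_on {0..l} (\<lambda>k. \<phi> (b k))"
  proof (rule mono_onI)
    fix i k
    assume "i \<in> {0..l}" "k \<in> {0..l}" "i \<le> k"
    then show "\<phi> (b i) \<le> \<phi> (b k)"
      using assms(5) b_mono[of i k] by (intro mono_onD[OF assms(6)]) auto
  qed
  note f_le = le_value_at_later_breakpoint[OF rf \<phi>b_mono r_bounds(1)]
  have less_iff: "r < b k \<longleftrightarrow> 0 < b k * z - y" for k
    using assms(1)[OF yz] by (simp add: r divide_less_eq)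
  define \<delta> :: "nat \<Rightarrow> real"
    where "\<delta> = (\<lambda>k\<in>{1..l}. if r < b k then 1 else 0)"
  have "f - \<phi> (b k) \<le> N * (1 - \<delta> k)" if k: "k \<in> {1..l}" for k
  proof (cases "r < b k")
    case True
    then show ?thesis using f_le[of k] k by (simp add: \<delta>_def)
  next
    case False
    then show ?thesis
      using f_le[of l] r_bounds(2) assms(8)[OF k] k by (simp add: \<delta>_def)
  qed
  moreover have "b k * z - y \<le> M * \<delta> k" if k: "k \<in> {1..l}" for k
    using assms(7)[OF yz k] less_iff[of k] k by (simp add: \<delta>_def)
  moreover have "\<delta> (k - 1) \<le> \<delta> k" if k: "k \<in> {2..l}" for k
    using b_mono[of "k - 1" k] k by (auto simp: \<delta>_def)
  moreover have "\<delta> \<in> {1..l} \<rightarrow>\<^sub>E {0, 1}"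
    by (auto simp: \<delta>_def)
  ultimately have "(y, z, f, \<delta>) \<in> step_hat M N l b B \<phi>"
    using yz by (simp add: step_hat_def)
  then show "(r, f) \<in> proj_ratio (step_hat M N l b B \<phi>)"
    using r by (auto simp: proj_ratio_def)
qed

end
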